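(* Let $n,t,k_1,\ldots,k_t$ be positive integers, let $k=\max\{k_i : i\in[t]\}$, and suppose $n>3k^2t$. For $i\in[t]$, let $\mathcal{F}_i\subseteq\binom{[n]}{k_i}$ be such that $$|\mathcal{F}_i|>\binom{n}{k_i}-\binom{n-t+1}{k_i}.$$ Then $\{\mathcal{F}_1,\ldots,\mathcal{F}_t\}$ admits a rainbow matching.
   Context: For a positive integer $m$, $[m]:=\{1,\ldots,m\}$, and for a set $S$, $\binom{S}{m}:=\{T\subseteq S: |T|=m\}$. A rainbow matching for families of sets $\mathcal{F}_1,\ldots,\mathcal{F}_t$ is a choice of sets $e_i\in\mathcal{F}_i$, one for each $i\in[t]$, that are pairwise disjoint. The family $\{\mathcal{F}_1,\ldots,\mathcal{F}_t\}$ admits a rainbow matching if one exists; it is understood as an indexed family. *)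

theory Defs
  imports "HOL-Library.Ramsey" "HOL-Library.Disjoint_Sets"
begin

text \<open>Families of sets are indexed by \<open>{1..t}\<close>; repetitions among the \<open>F i\<close> are allowed,
  and the values \<open>F i\<close> for \<open>i\<close> outside \<open>{1..t}\<close> are irrelevant.\<close>

definition rainbow_matching :: "nat \<Rightarrow> (nat \<Rightarrow> 'a set set) \<Rightarrow> (nat \<Rightarrow> 'a set) \<Rightarrow> bool" where
  "rainbow_matching t F e \<longleftrightarrow> (\<forall>i\<in>{1..t}. e i \<in> F i) \<and> disjoint_family_on e {1..t}"

definition admits_rainbow_matching :: "nat \<Rightarrow> (nat \<Rightarrow> 'a set set) \<Rightarrow> bool" where
  "admits_rainbow_matching t F \<longleftrightarrow> (\<exists>e. rainbow_matching t F e)"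

end

theory Submission
  imports Defs "HOL-Combinatorics.Transposition"
begin

text \<open>The argument is that of Huang, Loh and Sudakov for families of equal uniformity, by
  induction on the number \<open>t\<close> of families. Let \<open>s = t - 1\<close> and suppose that there is no rainbow
  matching. Write \<open>d i\<close> for the number of \<open>k i\<close>-subsets of the ground set through two given
  points.

  Deleting a point \<open>v\<close> and one family \<open>F i\<close> preserves the size hypothesis, because the two changes
  in the bound cancel by Pascal's rule. So the other \<open>s\<close> families have a rainbow matching that
  avoids \<open>v\<close>, and its union \<open>U\<close>, of at most \<open>K * s\<close> points, meets every member of \<open>F i\<close>. This has
  two uses. The members of \<open>F i\<close> through \<open>v\<close> all meet \<open>U\<close>, so every degree in \<open>F i\<close> is at most
  \<open>K * s * d i\<close>. And \<open>card (F i)\<close> is at most the sum of the degrees of the points of \<open>U\<close>.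

  Call a point heavy for \<open>F i\<close> if its degree exceeds \<open>2 * s * d i\<close>. If every family had \<open>t\<close> heavy
  points, one could choose a different heavy point for each family and find a rainbow
  matching through the chosen points (\<open>rainbow_matching_through_vertices\<close>). So some \<open>F i\<close> has at
  most \<open>s\<close> heavy points. In its cover \<open>U\<close> the heavy points contribute at most
  \<open>s * (K * s * d i)\<close> and the others at most \<open>K * s * (2 * s * d i)\<close>, together
  \<open>3 * K * s ^ 2 * d i\<close>. For \<open>n > 3 * K ^ 2 * t\<close> this is too small (\<open>star_bound_ge\<close>).

  The matching through heavy points comes from the links of these points by a cruder
  criterion, \<open>rainbow_matching_if_large\<close>: it needs \<open>card (G i) > s * (n choose (k i - 1))\<close> but only
  about \<open>t * k i\<close> points. That criterion is proved by compression.\<close>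

section \<open>Rainbow matchings and uniform families\<close>

text \<open>Arbitrary index sets let the inductions remove an arbitrary family without reindexing.\<close>

definition has_rainbow_matching :: "'i set \<Rightarrow> ('i \<Rightarrow> 'a set set) \<Rightarrow> bool" where
  "has_rainbow_matching I G \<longleftrightarrow> (\<exists>e. (\<forall>i\<in>I. e i \<in> G i) \<and> disjoint_family_on e I)"

lemma has_rainbow_matchingI:
  assumes "\<And>i. i \<in> I \<Longrightarrow> e i \<in> G i" "disjoint_family_on e I"
  shows "has_rainbow_matching I G"
  using assms unfolding has_rainbow_matching_def by blast

lemma has_rainbow_matchingE:
  assumes "has_rainbow_matching I G"
  obtains e where "\<And>i. i \<in> I \<Longrightarrow> e i \<in> G i" "disjoint_family_on e I"
  using assms unfolding has_rainbow_matching_def by blast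

lemma finite_uniform_family: "finite V \<Longrightarrow> G \<subseteq> nsets V k \<Longrightarrow> finite G"
  using finite_imp_finite_nsets finite_subset by metis

lemma card_nsets_containing_le:
  assumes "finite V" "S \<subseteq> V" "card S \<le> k"
  shows "card {A \<in> nsets V k. S \<subseteq> A} \<le> (card V - card S) choose (k - card S)"
proof -
  have fS: "finite S" using assms finite_subset by auto
  have "card {A \<in> nsets V k. S \<subseteq> A} \<le> card (nsets (V - S) (k - card S))"
  proof (rule card_inj_on_le[where f = "\<lambda>A. A - S"])
    show "inj_on (\<lambda>A. A - S) {A \<in> nsets V k. S \<subseteq> A}"
      by (auto simp: inj_on_def)
    show "(\<lambda>A. A - S) ` {A \<in> nsets V k. S \<subseteq> A} \<subseteq> nsets (V - S) (k - card S)"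
      using fS by (auto simp: nsets_def card_Diff_subset)
    show "finite (nsets (V - S) (k - card S))"
      using assms finite_imp_finite_nsets by blast
  qed
  also have "\<dots> = (card V - card S) choose (k - card S)"
    using assms fS by (simp add: card_nsets card_Diff_subset)
  finally show ?thesis .
qed

lemma exists_distinct_choice:
  assumes "finite I" "\<And>i. i \<in> I \<Longrightarrow> card I \<le> card (H i)"
  shows "\<exists>g. inj_on g I \<and> (\<forall>i\<in>I. g i \<in> H i)"
  using assms
proof (induction I rule: finite_induct)
  case empty
  then show ?case by simp
next
  case (insert i I)
  have "card I \<le> card (H j)" if "j \<in> I" for j
    using insert.prems[of j] insert.hyps that by simp
  then obtain g where g: "inj_on g I" "\<forall>j\<in>I. g j \<in> H j"
    using insert.IH by blast
  have "card (g ` I) < card (H i)"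
    using insert.prems[of i] insert.hyps g by (simp add: card_image)
  then have "\<not> H i \<subseteq> g ` I"
    using insert.hyps by (metis card_mono finite_imageI leD)
  then obtain y where y: "y \<in> H i" "y \<notin> g ` I" by blast
  have eq: "(g(i := y)) j = g j" if "j \<in> I" for j using that insert.hyps by auto
  have "inj_on (g(i := y)) (insert i I)"
    using g y insert.hyps by (auto simp: inj_on_def)
  moreover have "\<forall>j\<in>insert i I. (g(i := y)) j \<in> H j"
    using g y by auto
  ultimately show ?case by blast
qed

section \<open>Compression\<close>

text \<open>The classical compression: in every member, \<open>v\<close> is replaced by \<open>x\<close> whenever this yields a set
  not yet in the family. It is written as a membership condition on the pair \<open>A\<close>,
  \<open>transpose v x ` A\<close>: of such a pair separated by \<open>v\<close> and \<open>x\<close>, a single member moves to the side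
  of \<open>x\<close>, and two members both stay.\<close>

definition shift :: "'a \<Rightarrow> 'a \<Rightarrow> 'a set set \<Rightarrow> 'a set set" where
  "shift v x G = {A. if v \<in> A \<and> x \<notin> A then A \<in> G \<and> transpose v x ` A \<in> G
                     else if x \<in> A \<and> v \<notin> A then A \<in> G \<or> transpose v x ` A \<in> G
                     else A \<in> G}"

lemma mem_transpose_image:
  "v \<in> transpose v x ` A \<longleftrightarrow> x \<in> A" "x \<in> transpose v x ` A \<longleftrightarrow> v \<in> A"
  by (auto simp: in_transpose_image_iff)

lemma transpose_image_involutory: "transpose v x ` transpose v x ` A = A"
  by (simp add: image_comp)

lemma card_shift: "card (shift v x G) = card G"
proof -
  let ?T = "\<lambda>A. transpose v x ` A"
  let ?s = "\<lambda>A. if v \<in> A \<and> x \<notin> A \<and> ?T A \<notin> G then ?T A else A"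
  let ?r = "\<lambda>A. if A \<in> G then A else ?T A"
  have "bij_betw ?s G (shift v x G)"
  proof (rule bij_betw_byWitness[where f' = ?r])
    show "\<forall>A\<in>G. ?r (?s A) = A"
      by (auto simp: transpose_image_involutory simp del: transpose_image_eq)
    show "\<forall>A\<in>shift v x G. ?s (?r A) = A"
      by (auto simp: shift_def transpose_image_involutory mem_transpose_image
               simp del: transpose_image_eq split: if_splits)
    show "?s ` G \<subseteq> shift v x G"
    proof (rule image_subsetI)
      fix A assume "A \<in> G"
      then show "?s A \<in> shift v x G"
        by (cases "v \<in> A"; cases "x \<in> A"; cases "?T A \<in> G")
          (simp_all add: shift_def transpose_image_involutory mem_transpose_image
            del: transpose_image_eq)
    qed
    show "?r ` shift v x G \<subseteq> G"
      by (auto simp: shift_def simp del: transpose_image_eq split: if_splits)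
  qed
  then show ?thesis by (rule bij_betw_same_card[symmetric])
qed

lemma shift_uniform:
  assumes "G \<subseteq> nsets V k" "v \<in> V" "x \<in> V"
  shows "shift v x G \<subseteq> nsets V k"
proof
  fix A assume A: "A \<in> shift v x G"
  show "A \<in> nsets V k"
  proof (cases "A \<in> G")
    case False
    with A have T: "transpose v x ` A \<in> nsets V k"
      using assms(1) by (auto simp: shift_def simp del: transpose_image_eq split: if_splits)
    have "card (transpose v x ` A) = card A" "finite (transpose v x ` A) = finite A"
      by (simp_all add: card_image finite_image_iff)
    moreover have "A = transpose v x ` transpose v x ` A"
      by (simp only: transpose_image_involutory)
    then have "A \<subseteq> transpose v x ` V"
      using T by (metis (no_types, lifting) image_mono mem_Collect_eq nsets_def)
    ultimately show ?thesis using T assms by (auto simp: nsets_def)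
  qed (use assms in auto)
qed

text \<open>In a rainbow matching of the compressed families at most one set is new, since it
  contains \<open>x\<close>. Then exchanging \<open>v\<close> and \<open>x\<close> in all the sets of the matching at once brings every
  set back: the new set returns to its origin, and a set that contains \<open>v\<close> but not \<open>x\<close> can have
  survived compression only because its exchanged version is also in the original family.\<close>

lemma shift_has_rainbow_matching_imp:
  assumes "has_rainbow_matching I (\<lambda>i. shift v x (G i))"
  shows "has_rainbow_matching I G"
proof -
  obtain e where e: "\<And>i. i \<in> I \<Longrightarrow> e i \<in> shift v x (G i)" and d: "disjoint_family_on e I"
    using assms by (rule has_rainbow_matchingE) blast
  show ?thesis
  proof (cases "\<forall>i\<in>I. e i \<in> G i")
    case True
    with d show ?thesis by (auto intro: has_rainbow_matchingI)
  next
    case False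
    then obtain i where i: "i \<in> I" "e i \<notin> G i" by blast
    then have xi: "x \<in> e i" and Ti: "transpose v x ` e i \<in> G i"
      using e[OF i(1)] by (auto simp: shift_def simp del: transpose_image_eq split: if_splits)
    have mem: "transpose v x ` e j \<in> G j" if j: "j \<in> I" for j
    proof (cases "j = i")
      case False
      then have nx: "x \<notin> e j" using d i j xi by (auto simp: disjoint_family_on_def)
      show ?thesis
      proof (cases "v \<in> e j")
        case True
        then show ?thesis using e[OF j] nx by (auto simp: shift_def simp del: transpose_image_eq)
      next
        case False
        then show ?thesis using e[OF j] nx by (simp add: shift_def)
      qed
    qed (use Ti in simp)
    have "disjoint_family_on (\<lambda>j. transpose v x ` e j) I"
      using d by (auto simp: disjoint_family_on_def simp flip: image_Int simp del: transpose_image_eq)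
    with mem show ?thesis by (rule has_rainbow_matchingI)
  qed
qed

lemma shift_containing_subset: "{A \<in> shift v x G. v \<in> A} \<subseteq> {A \<in> G. v \<in> A}"
  by (auto simp: shift_def split: if_splits)

lemma shift_containing_less:
  assumes "finite G" "A \<in> G" "v \<in> A" "x \<notin> A" "transpose v x ` A \<notin> G"
  shows "card {A \<in> shift v x G. v \<in> A} < card {A \<in> G. v \<in> A}"
proof (rule psubset_card_mono)
  have "A \<in> {A \<in> G. v \<in> A} - {A \<in> shift v x G. v \<in> A}"
    using assms by (simp add: shift_def)
  then show "{A \<in> shift v x G. v \<in> A} \<subset> {A \<in> G. v \<in> A}"
    using shift_containing_subset[of v x G] by blast
qed (use assms in auto)

definition stable_at :: "'a set \<Rightarrow> 'a \<Rightarrow> 'a set set \<Rightarrow> bool" where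
  "stable_at V v G \<longleftrightarrow> (\<forall>A\<in>G. \<forall>x\<in>V. v \<in> A \<longrightarrow> x \<notin> A \<longrightarrow> transpose v x ` A \<in> G)"

text \<open>Every compression that changes a family lowers the number of its members through \<open>v\<close>, so
  compressing repeatedly reaches families that no compression away from \<open>v\<close> changes.\<close>

lemma reduce_to_stable:
  fixes G :: "'i \<Rightarrow> 'a set set"
  assumes V: "finite V" "v \<in> V" and I: "finite I"
    and stable: "\<And>H :: 'i \<Rightarrow> 'a set set. (\<And>i. i \<in> I \<Longrightarrow> H i \<subseteq> nsets V (k i)) \<Longrightarrow>
            (\<And>i. i \<in> I \<Longrightarrow> card (H i) = card (G i)) \<Longrightarrow>
            (\<And>i. i \<in> I \<Longrightarrow> stable_at V v (H i)) \<Longrightarrow> has_rainbow_matching I H"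
    and G: "\<And>i. i \<in> I \<Longrightarrow> G i \<subseteq> nsets V (k i)"
  shows "has_rainbow_matching I G"
proof -
  have "has_rainbow_matching I H"
    if "\<And>i. i \<in> I \<Longrightarrow> H i \<subseteq> nsets V (k i)" "\<And>i. i \<in> I \<Longrightarrow> card (H i) = card (G i)"
    for H :: "'i \<Rightarrow> 'a set set"
    using that
  proof (induction "\<Sum>i\<in>I. card {A \<in> H i. v \<in> A}" arbitrary: H rule: less_induct)
    case less
    show ?case
    proof (cases "\<forall>i\<in>I. stable_at V v (H i)")
      case True
      with less.prems show ?thesis by (intro stable) auto
    next
      case False
      then obtain i A x where w: "i \<in> I" "A \<in> H i" "x \<in> V" "v \<in> A" "x \<notin> A"
          "transpose v x ` A \<notin> H i"
        unfolding stable_at_def by blast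
      have fin: "finite (H j)" if "j \<in> I" for j
        using finite_uniform_family V less.prems(1) that by metis
      have "(\<Sum>j\<in>I. card {A \<in> shift v x (H j). v \<in> A}) < (\<Sum>j\<in>I. card {A \<in> H j. v \<in> A})"
      proof (rule sum_strict_mono_ex1[OF I])
        show "\<forall>j\<in>I. card {A \<in> shift v x (H j). v \<in> A} \<le> card {A \<in> H j. v \<in> A}"
          using fin by (intro ballI card_mono[OF _ shift_containing_subset]) simp
        show "\<exists>j\<in>I. card {A \<in> shift v x (H j). v \<in> A} < card {A \<in> H j. v \<in> A}"
          using shift_containing_less[OF fin[OF w(1)] w(2,4,5,6)] w(1) by blast
      qed
      then have "has_rainbow_matching I (\<lambda>j. shift v x (H j))"
        using less.prems V w(3) by (intro less.hyps) (simp_all add: shift_uniform card_shift)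
      then show ?thesis by (rule shift_has_rainbow_matching_imp)
    qed
  qed
  then show ?thesis using G by blast
qed

section \<open>A matching criterion for small ground sets\<close>

text \<open>This is \<open>n choose (k - 1)\<close> with the convention that a binomial coefficient with lower
  index \<open>-1\<close> vanishes. The case \<open>k = 0\<close> occurs in the induction, because links of points lower the
  uniformity, and there a family only has to be nonempty.\<close>

definition matching_threshold :: "nat \<Rightarrow> nat \<Rightarrow> nat" where
  "matching_threshold n k = (if k = 0 then 0 else n choose (k - 1))"

lemma matching_threshold_Suc:
  "k > 0 \<Longrightarrow> matching_threshold (Suc n) k = matching_threshold n k + matching_threshold n (k - 1)"
  using binomial_Suc_Suc[of n "k - 2"]
  by (cases "k = 1") (simp_all add: matching_threshold_def Suc_diff_Suc numeral_2_eq_2)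

text \<open>On \<open>t * k - 1\<close> points the threshold of the criterion below is the number of all
  \<open>k\<close>-sets, so no family can exceed it. This rules out the boundary case of that criterion, in which its
  induction would run out of points.\<close>

lemma choose_eq_threshold:
  assumes "t * k = Suc n"
  shows "n choose k = (t - 1) * matching_threshold n k"
proof -
  obtain k' where k: "k = Suc k'" using assms by (cases k) auto
  have "k * (n choose k) = (n - k') * (n choose k')"
    unfolding k binomial_absorption by (rule binomial_absorb_comp[symmetric])
  also have "n - k' = k * (t - 1)"
    using assms k by (cases t) (auto simp: algebra_simps)
  finally have "k * (n choose k) = k * ((t - 1) * (n choose k'))" by (simp only: mult.assoc)
  then have "n choose k = (t - 1) * (n choose k')" using k mult_left_cancel[of k "n choose k" "(t - 1) * (n choose k')"] by blast
  then show ?thesis using k by (simp add: matching_threshold_def)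
qed

lemma card_split_at:
  assumes "finite G"
  shows "card G = card {A \<in> G. v \<notin> A} + card ((\<lambda>A. A - {v}) ` {A \<in> G. v \<in> A})"
proof -
  have "card ((\<lambda>A. A - {v}) ` {A \<in> G. v \<in> A}) = card {A \<in> G. v \<in> A}"
    by (rule card_image) (auto simp: inj_on_def)
  moreover have "card G = card {A \<in> G. v \<notin> A} + card {A \<in> G. v \<in> A}"
    using assms by (subst card_Un_disjoint[symmetric]) (auto intro: arg_cong[where f = card])
  ultimately show ?thesis by simp
qed

text \<open>Induction on the ground set. Remove a point \<open>v\<close>; since the threshold obeys Pascal's rule, each
  family keeps the hypothesis either for its members avoiding \<open>v\<close> or for its link at \<open>v\<close>. The
  induction hypothesis gives a matching of the chosen families. Its sets from links each lack one
  point, and \<open>v\<close> can serve only one of them. But \<open>reduce_to_stable\<close> allows one to assume that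
  the families are stable under compression away from \<open>v\<close>; then any unused point does as well, and there are enough of them because
  \<open>card I * k i \<le> card V\<close> (the remaining case is void by \<open>choose_eq_threshold\<close>) for all \<open>i\<close> makes the sum of the \<open>k i\<close> at most \<open>card V\<close>.\<close>

theorem rainbow_matching_if_large:
  fixes G :: "'i \<Rightarrow> 'a set set"
  assumes "finite V" "finite I"
    and "\<And>i. i \<in> I \<Longrightarrow> G i \<subseteq> nsets V (k i)"
    and "\<And>i. i \<in> I \<Longrightarrow> card I * k i \<le> Suc (card V)"
    and "\<And>i. i \<in> I \<Longrightarrow> (card I - 1) * matching_threshold (card V) (k i) < card (G i)"
  shows "has_rainbow_matching I G"
  using assms(1,3-)
proof (induction "card V" arbitrary: V k G)
  case 0
  then have V: "V = {}" by simp
  have "{} \<in> G i" if i: "i \<in> I" for i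
  proof -
    have "G i \<noteq> {}" using 0(5)[OF i] by auto
    then show ?thesis using 0(3)[OF i] V by (auto simp: nsets_def)
  qed
  then show ?case by (intro has_rainbow_matchingI[where e = "\<lambda>_. {}"]) (auto simp: disjoint_family_on_def)
next
  case (Suc n)
  let ?t = "card I"
  obtain v where v: "v \<in> V" using Suc.hyps(2) by fastforce
  have tk: "?t * k i \<le> card V" if i: "i \<in> I" for i
  proof (rule ccontr)
    assume "\<not> ?thesis"
    then have "?t * k i = Suc (card V)" using Suc.prems(3)[OF i] by simp
    then have "card V choose k i < card (G i)"
      using Suc.prems(4)[OF i] choose_eq_threshold by metis
    moreover have "card (G i) \<le> card V choose k i"
      using Suc.prems(1,2) i by (metis card_mono card_nsets finite_imp_finite_nsets)
    ultimately show False by simp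
  qed
  show ?case
  proof (rule reduce_to_stable[OF Suc.prems(1) v \<open>finite I\<close> _ Suc.prems(2)])
    fix H :: "'i \<Rightarrow> 'a set set"
    assume H: "\<And>i. i \<in> I \<Longrightarrow> H i \<subseteq> nsets V (k i)"
      and cH: "\<And>i. i \<in> I \<Longrightarrow> card (H i) = card (G i)"
      and st: "\<And>i. i \<in> I \<Longrightarrow> stable_at V v (H i)"
    let ?D = "\<lambda>i. {A \<in> H i. v \<notin> A}" and ?L = "\<lambda>i. (\<lambda>A. A - {v}) ` {A \<in> H i. v \<in> A}"
    \<comment> \<open>\<open>J\<close> collects the families for which the link at \<open>v\<close> has to be used.\<close>
    define J where "J = {i \<in> I. (?t - 1) * matching_threshold n (k i) \<ge> card (?D i)}"
    define G' where "G' = (\<lambda>i. if i \<in> J then ?L i else ?D i)"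
    define k' where "k' = (\<lambda>i. if i \<in> J then k i - 1 else k i)"
    have JI: "J \<subseteq> I" "finite J" unfolding J_def using \<open>finite I\<close> by auto
    have cV: "card (V - {v}) = n" using Suc v by (metis Suc_inject card_Suc_Diff1)
    have finH: "finite (H i)" if "i \<in> I" for i
      using finite_uniform_family[OF Suc.prems(1)] H that by blast
    have large: "(?t - 1) * matching_threshold n (k' i) < card (G' i) \<and> (i \<in> J \<longrightarrow> k i > 0)"
      if i: "i \<in> I" for i
    proof (cases "i \<in> J")
      case True
      have sum: "card (H i) = card (?D i) + card (?L i)"
        using card_split_at[OF finH[OF i]] .
      have big: "(?t - 1) * matching_threshold (Suc n) (k i) < card (H i)"
        using Suc.prems(4)[OF i] cH[OF i] Suc.hyps(2) by simp
      have k0: "k i > 0"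
      proof (rule ccontr)
        assume "\<not> 0 < k i"
        then have k: "k i = 0" by simp
        then have "H i \<subseteq> {{}}" using H[OF i] by (auto simp: nsets_def)
        then have "?L i = {}" by blast
        then have "card (?L i) = 0" by (metis card.empty)
        with sum big True k show False by (simp add: J_def matching_threshold_def)
      qed
      have "(?t - 1) * matching_threshold (Suc n) (k i) =
          (?t - 1) * matching_threshold n (k i) + (?t - 1) * matching_threshold n (k i - 1)"
        using matching_threshold_Suc[OF k0] by (simp add: distrib_left)
      moreover have "card (?D i) \<le> (?t - 1) * matching_threshold n (k i)"
        using True by (simp add: J_def)
      ultimately have "(?t - 1) * matching_threshold n (k i - 1) < card (?L i)"
        using sum big by linarith
      then show ?thesis using True k0 by (simp add: G'_def k'_def)
    next
      case False
      then show ?thesis using i by (simp add: J_def G'_def k'_def)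
    qed
    have unif: "G' i \<subseteq> nsets (V - {v}) (k' i)" if i: "i \<in> I" for i
      using H[OF i] by (auto simp: G'_def k'_def nsets_def)
    have "has_rainbow_matching I G'"
    proof (rule Suc.hyps(1)[of "V - {v}" G' k'])
      show "?t * k' i \<le> Suc (card (V - {v}))" if "i \<in> I" for i
      proof -
        have "?t * k' i \<le> ?t * k i" by (simp add: k'_def)
        then show ?thesis using tk[OF that] cV Suc.hyps(2) by linarith
      qed
    qed (use unif large cV Suc.prems(1) in auto)
    then obtain e where e: "\<And>i. i \<in> I \<Longrightarrow> e i \<in> G' i" and d: "disjoint_family_on e I"
      by (rule has_rainbow_matchingE) blast
    have eV: "e i \<subseteq> V - {v}" "card (e i) = k' i" "finite (e i)" if "i \<in> I" for i
      using e[OF that] unif[OF that] by (auto simp: nsets_def)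
    let ?U = "\<Union>i\<in>I. e i"
    have sumk: "(\<Sum>i\<in>I. k i) \<le> card V"
    proof (cases "I = {}")
      case False
      then have t0: "?t > 0" using \<open>finite I\<close> by (simp add: card_gt_0_iff)
      have "?t * (\<Sum>i\<in>I. k i) \<le> ?t * card V"
        unfolding sum_distrib_left using sum_bounded_above[of I "\<lambda>i. ?t * k i", OF tk] by simp
      then show ?thesis using t0 by simp
    qed simp
    have "card ?U = (\<Sum>i\<in>I. k' i)"
      using card_UN_disjoint[of I e] d eV \<open>finite I\<close> by (simp add: disjoint_family_on_def)
    moreover have "(\<Sum>i\<in>I. k i) = (\<Sum>i\<in>I. k' i + (if i \<in> J then 1 else 0))"
      using large by (intro sum.cong) (auto simp: k'_def)
    then have "(\<Sum>i\<in>I. k i) = (\<Sum>i\<in>I. k' i) + card J"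
      using JI \<open>finite I\<close> by (simp add: sum.distrib sum.If_cases Int_absorb1)
    ultimately have "card J \<le> card V - card ?U" using sumk by simp
    also have "\<dots> \<le> card (V - ?U)"
      by (rule diff_card_le_card_Diff) (use eV \<open>finite I\<close> in auto)
    finally obtain g where g: "inj_on g J" "\<forall>i\<in>J. g i \<in> V - ?U"
      using exists_distinct_choice[of J "\<lambda>_. V - ?U"] JI by blast
    define f where "f = (\<lambda>i. if i \<in> J then insert (g i) (e i) else e i)"
    show "has_rainbow_matching I H"
    proof (rule has_rainbow_matchingI[of _ f])
      fix i assume i: "i \<in> I"
      show "f i \<in> H i"
      proof (cases "i \<in> J")
        case True
        then obtain A where A: "A \<in> H i" "v \<in> A" "e i = A - {v}"
          using e[OF i] by (auto simp: G'_def)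
        have gi: "g i \<in> V" "g i \<notin> e i" using g True i by auto
        show ?thesis
        proof (cases "g i = v")
          case True
          then show ?thesis using A \<open>i \<in> J\<close> by (simp add: f_def insert_absorb)
        next
          case False
          then have "transpose v (g i) ` A \<in> H i"
            using st[OF i] A gi by (auto simp: stable_at_def simp del: transpose_image_eq)
          moreover have "transpose v (g i) ` A = insert (g i) (e i)"
          proof -
            have "transpose v (g i) y = y" if "y \<in> e i" for y
              using eV[OF i] gi that by (metis Diff_iff insertI1 subsetD transpose_apply_other)
            then have "transpose v (g i) ` e i = e i" by simp
            moreover have "A = insert v (e i)" using A by auto
            ultimately show ?thesis by simp
          qed
          ultimately show ?thesis using True by (simp add: f_def)
        qed
      next
        case False
        then show ?thesis using e[OF i] by (simp add: f_def G'_def)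
      qed
    next
      show "disjoint_family_on f I"
        unfolding disjoint_family_on_def
      proof (intro ballI impI)
        fix i j assume ij: "i \<in> I" "j \<in> I" "i \<noteq> j"
        have "e i \<inter> e j = {}" using d ij by (auto simp: disjoint_family_on_def)
        moreover have "i \<in> J \<Longrightarrow> g i \<notin> e j" "j \<in> J \<Longrightarrow> g j \<notin> e i" using g ij by auto
        moreover have "i \<in> J \<Longrightarrow> j \<in> J \<Longrightarrow> g i \<noteq> g j" using g(1) ij by (auto simp: inj_on_def)
        ultimately show "f i \<inter> f j = {}" by (auto simp: f_def)
      qed
    qed
  qed
qed

section \<open>Binomial estimates\<close>

text \<open>The next two estimates bound the telescoping sum of Pascal's rule by its smallest and by its
  largest term.\<close>

lemma choose_add_ge: "m * (a choose k) + (a choose Suc k) \<le> (a + m) choose Suc k"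
proof (induction m)
  case (Suc m)
  have "a choose k \<le> (a + m) choose k" by (rule binomial_right_mono) simp
  with Suc show ?case by simp
qed simp

lemma choose_add_le:
  "a + m \<le> Suc b \<Longrightarrow> (a + m) choose Suc k \<le> (a choose Suc k) + m * (b choose k)"
proof (induction m)
  case (Suc m)
  have "(a + m) choose k \<le> b choose k" using Suc.prems by (intro binomial_right_mono) simp
  moreover have "(a + m) choose Suc k \<le> (a choose Suc k) + m * (b choose k)" using Suc by simp
  ultimately show ?case by simp
qed simp

text \<open>With \<open>C = (n - 2) choose (k - 2)\<close> and \<open>t = s + 1\<close>, absorption gives \<open>(n - 1) choose (k - 1)\<close> \<open>=\<close>
  \<open>(n - 1) / (k - 1) * C\<close>. The identity \<open>(K - 1) * (3 * K + 3) = 3 * K ^ 2 - 3\<close> turns the hypothesis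
  on \<open>n\<close> into a factor of at least \<open>3 * K * t + 3 * t\<close>. The term \<open>3 * t\<close> absorbs the loss of at most
  \<open>(s - 1) * C\<close> in passing from \<open>(n - 1) choose (k - 1)\<close> down to \<open>(n - s) choose (k - 1)\<close>, of which
  the difference \<open>(n choose k) - ((n - s) choose k)\<close> contains \<open>s\<close> copies.\<close>

lemma star_bound_ge:
  fixes n k K s :: nat
  assumes "2 \<le> k" "k \<le> K" "3 * K ^ 2 * Suc s < n"
  shows "3 * K * s ^ 2 * ((n - 2) choose (k - 2)) + ((n - s) choose k) \<le> n choose k"
proof (cases s)
  case 0
  then show ?thesis by simp
next
  case (Suc r)
  let ?C = "(n - 2) choose (k - 2)"
  obtain l where l: "k = Suc (Suc l)" using assms(1) by (metis add_2_eq_Suc le_Suc_ex)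
  obtain L where L: "K = Suc L" using assms by (cases K) auto
  have sn: "Suc s < n"
  proof -
    have "1 * Suc s \<le> 3 * K ^ 2 * Suc s" using L by (intro mult_le_mono1) simp
    from le_less_trans[OF this assms(3)] show ?thesis by simp
  qed
  then obtain N where N: "n = Suc (Suc N)" by (metis less_imp_Suc_add add_Suc)
  have "Suc l * (3 * K * Suc s + 3 * Suc s) \<le> L * (3 * K * Suc s + 3 * Suc s)"
    using l L assms(2) by (intro mult_le_mono1) simp
  also have "\<dots> \<le> 3 * K ^ 2 * Suc s" unfolding L by (simp add: power2_eq_square algebra_simps)
  also have "\<dots> \<le> Suc N" using assms(3) N by simp
  finally have "Suc l * (3 * K * Suc s + 3 * Suc s) * ?C \<le> Suc N * ?C" by (rule mult_le_mono1)
  also have "Suc N * ?C = Suc l * (Suc N choose Suc l)"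
    using binomial_absorption[of l "Suc N"] l N by simp
  finally have "Suc l * ((3 * K * Suc s + 3 * Suc s) * ?C) \<le> Suc l * (Suc N choose Suc l)"
    by (simp only: mult.assoc)
  then have big: "(3 * K * Suc s + 3 * Suc s) * ?C \<le> Suc N choose Suc l"
    by (simp only: mult_le_cancel1)
  have "(n - s) + r = Suc N" using N Suc sn by simp
  then have "Suc N choose Suc l \<le> ((n - s) choose Suc l) + r * ?C"
    using choose_add_le[of "n - s" r N l] N l by simp
  with big have "(3 * K * Suc s + 3 * Suc s) * ?C \<le> ((n - s) choose Suc l) + r * ?C" by linarith
  moreover have "(3 * K * s + r) * ?C \<le> (3 * K * Suc s + 3 * Suc s) * ?C"
    using Suc by (intro mult_le_mono1) simp
  ultimately have "3 * K * s * ?C \<le> (n - s) choose Suc l" by (simp add: distrib_right)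
  then have "s * (3 * K * s * ?C) \<le> s * ((n - s) choose Suc l)" by (rule mult_le_mono2)
  moreover have "s * ((n - s) choose Suc l) + ((n - s) choose k) \<le> n choose k"
    using choose_add_ge[of s "n - s" "Suc l"] sn l by simp
  moreover have "s * (3 * K * s * ?C) = 3 * K * s ^ 2 * ?C"
    by (simp add: power2_eq_square)
  ultimately show ?thesis by linarith
qed

section \<open>Degrees\<close>

text \<open>For \<open>k < 2\<close> no \<open>k\<close>-set contains two points; truncated subtraction would give the value \<open>1\<close>.\<close>

definition pair_degree :: "nat \<Rightarrow> nat \<Rightarrow> nat" where
  "pair_degree n k = (if k < 2 then 0 else (n - 2) choose (k - 2))"

lemma card_containing_pair_le:
  assumes "finite V" "u \<in> V" "v \<in> V" "u \<noteq> v" "G \<subseteq> nsets V k"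
  shows "card {A \<in> G. u \<in> A \<and> v \<in> A} \<le> pair_degree (card V) k"
proof (cases "k < 2")
  case True
  have "\<not> (u \<in> A \<and> v \<in> A)" if "A \<in> G" for A
  proof
    assume "u \<in> A \<and> v \<in> A"
    moreover have "finite A" "card A = k" using that assms(5) by (auto simp: nsets_def)
    ultimately have "card {u, v} \<le> k" using card_mono[of A "{u, v}"] by auto
    then show False using True assms(4) by simp
  qed
  then have "{A \<in> G. u \<in> A \<and> v \<in> A} = {}" by blast
  then show ?thesis by (metis card.empty zero_le)
next
  case False
  have "card {A \<in> G. u \<in> A \<and> v \<in> A} \<le> card {A \<in> nsets V k. {u, v} \<subseteq> A}"
    using assms(1,5) by (intro card_mono) (auto simp: finite_imp_finite_nsets)
  also have "\<dots> \<le> (card V - card {u, v}) choose (k - card {u, v})"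
    using assms False by (intro card_nsets_containing_le) auto
  finally show ?thesis using False assms(4) by (simp add: pair_degree_def numeral_2_eq_2)
qed

lemma card_le_sum_degrees:
  assumes "finite U" "finite G" "\<And>A. A \<in> G \<Longrightarrow> A \<inter> U \<noteq> {}"
  shows "card G \<le> (\<Sum>u\<in>U. card {A \<in> G. u \<in> A})"
proof -
  have "card G \<le> card (\<Union>u\<in>U. {A \<in> G. u \<in> A})"
    using assms by (intro card_mono) auto
  also have "\<dots> \<le> (\<Sum>u\<in>U. card {A \<in> G. u \<in> A})"
    by (rule card_UN_le[OF assms(1)])
  finally show ?thesis .
qed

lemma degree_through_set_le:
  assumes "finite V" "U \<subseteq> V" "v \<in> V - U" "G \<subseteq> nsets V k"
    and "\<And>A. A \<in> G \<Longrightarrow> v \<in> A \<and> A \<inter> U \<noteq> {}"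
  shows "card G \<le> card U * pair_degree (card V) k"
proof -
  have "card G \<le> (\<Sum>u\<in>U. card {A \<in> G. u \<in> A})"
    using assms finite_subset finite_uniform_family by (intro card_le_sum_degrees) blast+
  also have "\<dots> \<le> (\<Sum>u\<in>U. pair_degree (card V) k)"
  proof (rule sum_mono)
    fix u assume u: "u \<in> U"
    have "{A \<in> G. u \<in> A} = {A \<in> G. u \<in> A \<and> v \<in> A}" using assms(5) by blast
    also have "card \<dots> \<le> pair_degree (card V) k"
      using assms u by (intro card_containing_pair_le) auto
    finally show "card {A \<in> G. u \<in> A} \<le> pair_degree (card V) k" .
  qed
  finally show ?thesis by simp
qed

text \<open>Half of the degree of \<open>g i\<close> pays for the members of \<open>F i\<close> that hit one of the other
  \<open>card I - 1\<close> chosen points. What is left, the link of \<open>g i\<close> outside all chosen points, still exceeds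
  the threshold of \<open>rainbow_matching_if_large\<close>: that threshold is \<open>card I - 1\<close> times a binomial
  coefficient of the \<open>card V - card I\<close> remaining points, which for \<open>card I \<ge> 2\<close> is at most the
  number of \<open>k i\<close>-sets through two points of \<open>V\<close>.\<close>

lemma rainbow_matching_through_vertices:
  fixes F :: "'i \<Rightarrow> 'a set set"
  assumes V: "finite V" and I: "finite I"
    and F: "\<And>i. i \<in> I \<Longrightarrow> F i \<subseteq> nsets V (k i)"
    and k: "\<And>i. i \<in> I \<Longrightarrow> 2 \<le> k i" "\<And>i. i \<in> I \<Longrightarrow> card I * k i \<le> card V"
    and g: "inj_on g I" "\<And>i. i \<in> I \<Longrightarrow> g i \<in> V"
    and deg: "\<And>i. i \<in> I \<Longrightarrow>
          2 * (card I - 1) * pair_degree (card V) (k i) < card {A \<in> F i. g i \<in> A}"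
  shows "has_rainbow_matching I F"
proof -
  define W where "W = V - g ` I"
  define Q where "Q = (\<lambda>i. {A \<in> F i. g i \<in> A \<and> A \<inter> g ` (I - {i}) = {}})"
  define L where "L = (\<lambda>i. (\<lambda>A. A - {g i}) ` Q i)"
  have finF: "finite (F i)" if "i \<in> I" for i
    using finite_uniform_family V F that by metis
  have cW: "card W = card V - card I"
    unfolding W_def using V I g by (subst card_Diff_subset) (auto simp: card_image)
  have cQ: "(card I - 1) * pair_degree (card V) (k i) < card (Q i)" if i: "i \<in> I" for i
  proof -
    let ?R = "{A \<in> F i. g i \<in> A \<and> A \<inter> g ` (I - {i}) \<noteq> {}}"
    have "{A \<in> F i. g i \<in> A} = Q i \<union> ?R" by (auto simp: Q_def)
    then have "card {A \<in> F i. g i \<in> A} \<le> card (Q i) + card ?R" by (simp only: card_Un_le)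
    moreover have "card ?R \<le> card (g ` (I - {i})) * pair_degree (card V) (k i)"
    proof (rule degree_through_set_le[OF V])
      show "g i \<in> V - g ` (I - {i})" using g i by (auto simp: inj_on_def)
    qed (use g F i in auto)
    moreover have "card (g ` (I - {i})) = card I - 1"
      using g(1) I i by (subst card_image) (auto simp: inj_on_def)
    ultimately show ?thesis using deg[OF i] by simp
  qed
  have Lsub: "L i \<subseteq> nsets W (k i - 1)" if i: "i \<in> I" for i
  proof
    fix B assume "B \<in> L i"
    then obtain A where A: "A \<in> F i" "g i \<in> A" "A \<inter> g ` (I - {i}) = {}" "B = A - {g i}"
      by (auto simp: L_def Q_def)
    have "A \<subseteq> V" "finite A" "card A = k i" using F[OF i] A(1) by (auto simp: nsets_def)
    then show "B \<in> nsets W (k i - 1)" using A by (auto simp: nsets_def W_def)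
  qed
  have "has_rainbow_matching I L"
  proof (rule rainbow_matching_if_large[of W I L "\<lambda>i. k i - 1"])
    fix i assume i: "i \<in> I"
    show "L i \<subseteq> nsets W (k i - 1)" by (rule Lsub[OF i])
    show "card I * (k i - 1) \<le> Suc (card W)"
      using k(2)[OF i] cW by (simp add: diff_mult_distrib2)
    have "card (L i) = card (Q i)"
      unfolding L_def by (rule card_image) (auto simp: inj_on_def Q_def)
    moreover have "(card I - 1) * matching_threshold (card W) (k i - 1)
          \<le> (card I - 1) * pair_degree (card V) (k i)"
    proof (cases "card I \<ge> 2")
      case True
      have "card W choose (k i - 2) \<le> (card V - 2) choose (k i - 2)"
        using True cW by (intro binomial_right_mono) simp
      then have "matching_threshold (card W) (k i - 1) \<le> pair_degree (card V) (k i)"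
        using k(1)[OF i] by (auto simp: matching_threshold_def pair_degree_def numeral_2_eq_2)
      then show ?thesis by (rule mult_le_mono2)
    qed auto
    ultimately show "(card I - 1) * matching_threshold (card W) (k i - 1) < card (L i)"
      using cQ[OF i] by linarith
  qed (use V I in \<open>auto simp: W_def\<close>)
  then obtain e where e: "\<And>i. i \<in> I \<Longrightarrow> e i \<in> L i" and d: "disjoint_family_on e I"
    by (rule has_rainbow_matchingE) blast
  show ?thesis
  proof (rule has_rainbow_matchingI)
    fix i assume i: "i \<in> I"
    show "insert (g i) (e i) \<in> F i"
      using e[OF i] by (auto simp: L_def Q_def insert_absorb)
  next
    have "e i \<inter> g ` I = {}" if "i \<in> I" for i
      using e[OF that] Lsub[OF that] by (auto simp: nsets_def W_def)
    then have "g j \<notin> e i" if "i \<in> I" "j \<in> I" for i j using that by blast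
    then show "disjoint_family_on (\<lambda>i. insert (g i) (e i)) I"
      using d g(1) by (auto simp: disjoint_family_on_def inj_on_eq_iff)
  qed
qed

section \<open>The size bound of the star-like extremal family\<close>

lemma has_rainbow_matching_extend:
  assumes e: "\<And>j. j \<in> I - {i} \<Longrightarrow> e j \<in> F j" "disjoint_family_on e (I - {i})"
    and A: "A \<in> F i" "A \<inter> (\<Union>j\<in>I - {i}. e j) = {}"
  shows "has_rainbow_matching I F"
proof (rule has_rainbow_matchingI[where e = "e(i := A)"])
  show "(e(i := A)) j \<in> F j" if "j \<in> I" for j using that e A by auto
  show "disjoint_family_on (e(i := A)) I"
    unfolding disjoint_family_on_def
  proof (intro ballI impI)
    fix j l assume "j \<in> I" "l \<in> I" "j \<noteq> l"
    then show "(e(i := A)) j \<inter> (e(i := A)) l = {}"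
      using e(2) A(2) by (cases "j = i"; cases "l = i") (auto simp: disjoint_family_on_def)
  qed
qed

text \<open>\<open>K\<close> is an upper bound instead of the maximum, so that it stays fixed while families are removed.
  The size hypothesis is additive to avoid subtraction of binomial coefficients; it says that
  \<open>F i\<close> is larger than the family of all \<open>k i\<close>-sets that meet a fixed set of \<open>card I - 1\<close> points.\<close>

theorem rainbow_matching_above_star_bound:
  fixes F :: "'i \<Rightarrow> 'a set set" and k :: "'i \<Rightarrow> nat"
  assumes "finite V" "finite I"
    and "\<And>i. i \<in> I \<Longrightarrow> 0 < k i" "\<And>i. i \<in> I \<Longrightarrow> k i \<le> K"
    and "3 * K ^ 2 * card I < card V"
    and "\<And>i. i \<in> I \<Longrightarrow> F i \<subseteq> nsets V (k i)"
    and "\<And>i. i \<in> I \<Longrightarrow> card V choose k i < card (F i) + ((card V - card I + 1) choose k i)"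
  shows "has_rainbow_matching I F"
  using assms
proof (induction "card I" arbitrary: I V F)
  case 0
  then show ?case by (auto simp: has_rainbow_matching_def disjoint_family_on_def)
next
  case (Suc s)
  note V = Suc.prems(1) and I = Suc.prems(2) and k0 = Suc.prems(3) and kK = Suc.prems(4)
    and F = Suc.prems(6)
  let ?n = "card V"
  let ?d = "\<lambda>i. pair_degree ?n (k i)"
  have cI: "card I = Suc s" using Suc.hyps(2) by simp
  have big: "3 * K ^ 2 * Suc s < ?n" using Suc.prems(5) cI by simp
  obtain i0 where "i0 \<in> I" using cI by fastforce
  then have K1: "1 \<le> K" using k0[of i0] kK[of i0] by linarith
  then have K2: "K \<le> K ^ 2" by (simp add: self_le_power)
  have tK: "Suc s * K \<le> ?n" "Suc s < ?n"
  proof -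
    have "K * Suc s \<le> 3 * K ^ 2 * Suc s" using K2 by (intro mult_le_mono1) simp
    then show "Suc s * K \<le> ?n" using big by (simp add: mult.commute)
    have "1 * Suc s \<le> 3 * K ^ 2 * Suc s" using K1 by (intro mult_le_mono1) simp
    from le_less_trans[OF this big] show "Suc s < ?n" by simp
  qed
  have size: "?n choose k i < card (F i) + ((?n - s) choose k i)" if "i \<in> I" for i
  proof -
    have "?n - card I + 1 = ?n - s" using cI tK(2) by simp
    then show ?thesis using Suc.prems(7)[OF that] by simp
  qed
  have finF: "finite (F i)" if "i \<in> I" for i
    using finite_uniform_family V F that by metis
  \<comment> \<open>Removing \<open>v\<close> costs \<open>F j\<close> at most \<open>(n - 1) choose (k j - 1)\<close> members. By Pascal's rule
      \<open>n choose k j\<close> drops by the same amount, while \<open>n - s\<close> is unaffected as one point and one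
      family disappear together.\<close>
  have avoid: "\<exists>e. (\<forall>j\<in>I - {i}. e j \<in> F j \<and> v \<notin> e j) \<and> disjoint_family_on e (I - {i})"
    if i: "i \<in> I" and v: "v \<in> V" for i v
  proof -
    have cV: "card (V - {v}) = ?n - 1" using V v by simp
    have cJ: "card (I - {i}) = s" using I i cI by simp
    have "has_rainbow_matching (I - {i}) (\<lambda>j. {A \<in> F j. v \<notin> A})"
    proof (rule Suc.hyps(1)[where V = "V - {v}"])
      have "3 * K ^ 2 * s + 1 \<le> 3 * K ^ 2 * Suc s" using K1 by simp
      from le_less_trans[OF this big] show "3 * K ^ 2 * card (I - {i}) < card (V - {v})"
        unfolding cV cJ by simp
    next
      fix j assume j: "j \<in> I - {i}"
      show "{A \<in> F j. v \<notin> A} \<subseteq> nsets (V - {v}) (k j)"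
        using F[of j] j by (auto simp: nsets_def)
      have "F j = {A \<in> F j. v \<notin> A} \<union> {A \<in> F j. v \<in> A}" by blast
      then have "card (F j) \<le> card {A \<in> F j. v \<notin> A} + card {A \<in> F j. v \<in> A}"
        by (metis (no_types, lifting) card_Un_le)
      moreover have "card {A \<in> F j. v \<in> A} \<le> card {A \<in> nsets V (k j). {v} \<subseteq> A}"
        using F[of j] j V by (intro card_mono) (auto simp: finite_imp_finite_nsets)
      moreover have "\<dots> \<le> (?n - card {v}) choose (k j - card {v})"
        using V v k0[of j] j by (intro card_nsets_containing_le) auto
      moreover have "?n choose k j = ((?n - 1) choose (k j - 1)) + ((?n - 1) choose k j)"
        using k0[of j] j tK(2) by (intro choose_reduce_nat) auto
      moreover have "?n - 1 - s + 1 = ?n - s" using tK(2) by simp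
      ultimately show "card (V - {v}) choose k j < card {A \<in> F j. v \<notin> A}
            + ((card (V - {v}) - card (I - {i}) + 1) choose k j)"
        using size[of j] j cV cJ by simp
    qed (use V I cJ k0 kK in auto)
    then obtain e where "\<And>j. j \<in> I - {i} \<Longrightarrow> e j \<in> {A \<in> F j. v \<notin> A}"
      "disjoint_family_on e (I - {i})" by (rule has_rainbow_matchingE) blast
    then show ?thesis by blast
  qed
  show ?case
  proof (rule ccontr)
    assume no: "\<not> ?case"
    have cover: "\<exists>U. U \<subseteq> V - {v} \<and> card U \<le> s * K \<and> (\<forall>A\<in>F i. A \<inter> U \<noteq> {})"
      if i: "i \<in> I" and v: "v \<in> V" for i v
    proof -
      obtain e where e: "\<forall>j\<in>I - {i}. e j \<in> F j \<and> v \<notin> e j" "disjoint_family_on e (I - {i})"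
        using avoid[OF i v] by blast
      let ?U = "\<Union>j\<in>I - {i}. e j"
      have ej: "e j \<subseteq> V - {v}" "card (e j) \<le> K" if "j \<in> I - {i}" for j
        using e(1) F[of j] kK[of j] that by (auto simp: nsets_def)
      have "card ?U \<le> (\<Sum>j\<in>I - {i}. card (e j))" using I by (intro card_UN_le) simp
      also have "\<dots> \<le> card (I - {i}) * K"
        using sum_bounded_above[of "I - {i}" "\<lambda>j. card (e j)" K] ej by simp
      also have "\<dots> = s * K" using I i cI by simp
      finally have "card ?U \<le> s * K" .
      moreover have "A \<inter> ?U \<noteq> {}" if "A \<in> F i" for A
        using has_rainbow_matching_extend[of I i e F A] e no that by blast
      moreover have "?U \<subseteq> V - {v}" using ej by blast
      ultimately show ?thesis by blast
    qed
    have deg_le: "card {A \<in> F i. v \<in> A} \<le> s * K * ?d i" if i: "i \<in> I" and v: "v \<in> V" for i v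
    proof -
      obtain U where U: "U \<subseteq> V - {v}" "card U \<le> s * K" "\<forall>A\<in>F i. A \<inter> U \<noteq> {}"
        using cover[OF i v] by blast
      have "card {A \<in> F i. v \<in> A} \<le> card U * ?d i"
        using U v F[OF i] by (intro degree_through_set_le[OF V, where v = v]) auto
      also have "\<dots> \<le> s * K * ?d i" using U(2) by (rule mult_le_mono1)
      finally show ?thesis .
    qed
    \<comment> \<open>A family of singletons cannot occur: its degrees would all be \<open>0\<close>, yet it is nonempty.\<close>
    have k2: "2 \<le> k i" if i: "i \<in> I" for i
    proof (rule ccontr)
      assume "\<not> 2 \<le> k i"
      then have "?d i = 0" by (simp add: pair_degree_def)
      have "(?n - s) choose k i \<le> ?n choose k i" by (rule binomial_right_mono) simp
      then have "F i \<noteq> {}" using size[OF i] by auto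
      then obtain A where A: "A \<in> F i" by blast
      then have "A \<subseteq> V" "A \<noteq> {}" using F[OF i] k0[OF i] by (auto simp: nsets_def)
      then obtain v where v: "v \<in> A" "v \<in> V" by blast
      have "card {A \<in> F i. v \<in> A} = 0"
        using deg_le[OF i v(2)] \<open>?d i = 0\<close> by simp
      then show False using A v finF[OF i] by auto
    qed
    \<comment> \<open>\<open>B i\<close> is the set of heavy points of \<open>F i\<close>.\<close>
    define B where "B = (\<lambda>i. {v \<in> V. 2 * s * ?d i < card {A \<in> F i. v \<in> A}})"
    have "\<exists>i\<in>I. card (B i) \<le> s"
    proof (rule ccontr)
      assume "\<not> ?thesis"
      then have "card I \<le> card (B i)" if "i \<in> I" for i using that cI by auto
      then obtain g where g: "inj_on g I" "\<forall>i\<in>I. g i \<in> B i"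
        using exists_distinct_choice[OF I, of B] by blast
      have "has_rainbow_matching I F"
      proof (rule rainbow_matching_through_vertices[OF V I F k2 _ g(1)])
        fix i assume i: "i \<in> I"
        have "Suc s * k i \<le> Suc s * K" using kK[OF i] by (rule mult_le_mono2)
        from le_trans[OF this tK(1)] show "card I * k i \<le> ?n" unfolding cI .
      qed (use g cI in \<open>auto simp: B_def\<close>)
      with no show False by blast
    qed
    then obtain i where i: "i \<in> I" "card (B i) \<le> s" by blast
    have "V \<noteq> {}" using tK(2) by auto
    then obtain v where v: "v \<in> V" by blast
    obtain U where Uv: "U \<subseteq> V - {v}" and U: "card U \<le> s * K" "\<forall>A\<in>F i. A \<inter> U \<noteq> {}"
      using cover[OF i(1) v] by blast
    have UV: "U \<subseteq> V" using Uv by blast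
    have finU: "finite U" using UV V by (rule finite_subset)
    let ?deg = "\<lambda>u. card {A \<in> F i. u \<in> A}"
    have "card (F i) \<le> (\<Sum>u\<in>U. ?deg u)"
      using U(2) by (intro card_le_sum_degrees[OF finU finF[OF i(1)]]) simp
    also have "\<dots> = (\<Sum>u\<in>U \<inter> B i. ?deg u) + (\<Sum>u\<in>U - B i. ?deg u)"
      using finU by (rule sum.Int_Diff)
    also have "\<dots> \<le> card (U \<inter> B i) * (s * K * ?d i) + card (U - B i) * (2 * s * ?d i)"
    proof (rule add_mono)
      show "(\<Sum>u\<in>U \<inter> B i. ?deg u) \<le> card (U \<inter> B i) * (s * K * ?d i)"
        using sum_bounded_above[of "U \<inter> B i" ?deg "s * K * ?d i"] deg_le[OF i(1) subsetD[OF UV]]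
        by simp
      have "?deg u \<le> 2 * s * ?d i" if "u \<in> U - B i" for u
        using that UV unfolding B_def by (metis (mono_tags, lifting) DiffE mem_Collect_eq not_less subsetD)
      then show "(\<Sum>u\<in>U - B i. ?deg u) \<le> card (U - B i) * (2 * s * ?d i)"
        using sum_bounded_above[of "U - B i" ?deg "2 * s * ?d i"] by simp
    qed
    also have "\<dots> \<le> s * (s * K * ?d i) + s * K * (2 * s * ?d i)"
    proof (intro add_mono mult_le_mono1)
      have "card (U \<inter> B i) \<le> card (B i)" using V by (intro card_mono) (auto simp: B_def)
      then show "card (U \<inter> B i) \<le> s" using i by simp
      have "card (U - B i) \<le> card U" using finU by (intro card_mono) auto
      then show "card (U - B i) \<le> s * K" using U(1) by simp
    qed
    also have "\<dots> = 3 * K * s ^ 2 * ((?n - 2) choose (k i - 2))"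
      using k2[OF i(1)] by (simp add: pair_degree_def power2_eq_square algebra_simps)
    finally show False
      using star_bound_ge[OF k2[OF i(1)] kK[OF i(1)] big] size[OF i(1)] by linarith
  qed
qed

theorem theorem1p5:
  fixes n t K :: nat and k :: "nat \<Rightarrow> nat" and F :: "nat \<Rightarrow> nat set set"
  assumes "n > 0" and "t > 0"
    and "\<And>i. i \<in> {1..t} \<Longrightarrow> k i > 0"
    and "K = Max (k ` {1..t})"
    and "n > 3 * K ^ 2 * t"
    and "\<And>i. i \<in> {1..t} \<Longrightarrow> F i \<subseteq> nsets {1..n} (k i)"
    and "\<And>i. i \<in> {1..t} \<Longrightarrow>
           int (card (F i)) > int (n choose k i) - int ((n - t + 1) choose k i)"
  shows "admits_rainbow_matching t F"
proof -
  have "has_rainbow_matching {1..t} F"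
  proof (rule rainbow_matching_above_star_bound[of "{1..n}" _ k K])
    show "k i \<le> K" if "i \<in> {1..t}" for i
      unfolding assms(4) using that by (intro Max_ge) auto
    show "card {1..n} choose k i < card (F i) + ((card {1..n} - card {1..t} + 1) choose k i)"
      if "i \<in> {1..t}" for i
      using assms(7)[OF that] by simp
  qed (use assms(3,5,6) in simp_all)
  then show ?thesis
    by (simp add: has_rainbow_matching_def admits_rainbow_matching_def rainbow_matching_def)
qed

end
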